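(* Let $a>1$ and let $f\in C[0,\infty)$ be increasing and $(1,a^x)$-convex (convex with respect to the function $a^x$). Then, for every $n\in\mathbb{N}$, $$f(x)\le S_{n,a}^*(f;x)\le S_n(f;x)\qquad\text{for all }x\in[0,\infty).$$
   Context: For $a>1$, $n\in\mathbb{N}=\{1,2,\dots\}$ and $x\ge 0$, define $$S_{n,a}^*(f;x)=\sum_{k=0}^{\infty}a^{\left(\frac{-x}{-1+a^{1/n}}\right)}\frac{(x\log a)^k}{(-1+a^{1/n})^k\,k!}\,f\!\left(\frac{k}{n}\right),$$ and the classical Szász-Mirakjan operators $$S_n(f;x)=\sum_{k=0}^{\infty}e^{-nx}\frac{(nx)^k}{k!}\,f\!\left(\frac{k}{n}\right),$$ for functions $f:[0,\infty)\to\mathbb{R}$; the series are assumed to converge for the function $f$ considered ($\log$ is the natural logarithm, and $0^0=1$). A function $f$ is called $(1,\sigma)$-convex (convex with respect to $\sigma$), where here $\sigma(x)=a^x$, if $$\begin{vmatrix}1&1&1\\ \sigma(x_1)&\sigma(x_2)&\sigma(x_3)\\ f(x_1)&f(x_2)&f(x_3)\end{vmatrix}\ge 0\qquad\text{whenever } 0\le x_1<x_2<x_3<\infty.$$ *)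

theory Defs
  imports "HOL-Analysis.Determinants"
begin

text \<open>Functions on the half-line \<open>[0, \<infinity>)\<close> are total functions of type \<open>real \<Rightarrow> real\<close>; only their
  values at nonnegative arguments occur below.\<close>

definition convex_wrt :: "(real \<Rightarrow> real) \<Rightarrow> (real \<Rightarrow> real) \<Rightarrow> bool" where
  "convex_wrt \<sigma> f \<longleftrightarrow> (\<forall>x1 x2 x3. 0 \<le> x1 \<and> x1 < x2 \<and> x2 < x3 \<longrightarrow>
     det (vector [vector [1, 1, 1],
                  vector [\<sigma> x1, \<sigma> x2, \<sigma> x3],
                  vector [f x1, f x2, f x3]] :: real^3^3) \<ge> 0)"

definition szasz_star_term :: "nat \<Rightarrow> real \<Rightarrow> (real \<Rightarrow> real) \<Rightarrow> real \<Rightarrow> nat \<Rightarrow> real" where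
  "szasz_star_term n a f x k =
     a powr (- x / (- 1 + a powr (1 / real n))) *
     ((x * ln a) ^ k / ((- 1 + a powr (1 / real n)) ^ k * fact k)) * f (real k / real n)"

definition szasz_term :: "nat \<Rightarrow> (real \<Rightarrow> real) \<Rightarrow> real \<Rightarrow> nat \<Rightarrow> real" where
  "szasz_term n f x k =
     exp (- (real n * x)) * ((real n * x) ^ k / fact k) * f (real k / real n)"

text \<open>The two operators are meaningful only where the series of their terms is
  \<^const>\<open>summable\<close>; \<^const>\<open>suminf\<close> is unspecified otherwise.\<close>

definition szasz_star :: "nat \<Rightarrow> real \<Rightarrow> (real \<Rightarrow> real) \<Rightarrow> real \<Rightarrow> real" where
  "szasz_star n a f x = (\<Sum>k. szasz_star_term n a f x k)"

definition szasz :: "nat \<Rightarrow> (real \<Rightarrow> real) \<Rightarrow> real \<Rightarrow> real" where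
  "szasz n f x = (\<Sum>k. szasz_term n f x k)"

end

theory Submission
  imports Defs
begin

text \<open>
  Both operators average the values \<open>f (k / n)\<close> against a Poisson distribution in \<open>k\<close>: the classical
  one with mean \<open>n * x\<close>, the modified one with mean \<open>\<nu> = x * ln a / b\<close>, where \<open>b = a powr (1/n) - 1\<close>.
  This mean is the one for which the average of \<open>a powr (k / n)\<close> is \<open>a powr x\<close>, because the
  generating function of the Poisson distribution, \<open>z \<mapsto> exp (\<nu> * (z - 1))\<close>, takes the value
  \<open>exp (\<nu> * b) = a powr x\<close> at \<open>z = 1 + b = a powr (1/n)\<close>.

  The lower estimate is therefore Jensen's inequality for functions convex with respect to
  \<open>t \<mapsto> a powr t\<close>: such an \<open>f\<close> lies above a function of the form
  \<open>f x + m * (a powr t - a powr x)\<close> that touches it at \<open>x > 0\<close> (lemma \<open>supporting_slope\<close>), and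
  averaging this bound leaves only \<open>f x\<close>. At \<open>x = 0\<close> both operators return \<open>f 0\<close>.

  For the upper estimate, \<open>1 + ln a / n \<le> exp (ln a / n)\<close> gives \<open>\<nu> \<le> n * x\<close>, and the average of an
  increasing sequence over a Poisson distribution increases with the mean (lemma \<open>poisson_mono\<close>).
\<close>

section \<open>Poisson averages\<close>

definition poisson_weight :: "real \<Rightarrow> nat \<Rightarrow> real" where
  "poisson_weight \<nu> k = exp (- \<nu>) * (\<nu> ^ k / fact k)"

lemma poisson_generating_function:
  "(\<lambda>k. poisson_weight \<nu> k * z ^ k) sums exp (\<nu> * (z - 1))"
proof -
  have "(\<lambda>k. exp (- \<nu>) * ((\<nu> * z) ^ k /\<^sub>R fact k)) sums (exp (- \<nu>) * exp (\<nu> * z))"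
    by (intro sums_mult exp_converges)
  moreover have "exp (- \<nu>) * exp (\<nu> * z) = exp (\<nu> * (z - 1))"
    by (simp add: algebra_simps flip: exp_add)
  ultimately show ?thesis
    by (simp add: poisson_weight_def power_mult_distrib field_simps)
qed

lemma poisson_weight_sums: "poisson_weight \<nu> sums 1"
  using poisson_generating_function[of \<nu> 1] by simp

lemma poisson_weight_nonneg: "0 \<le> \<nu> \<Longrightarrow> 0 \<le> poisson_weight \<nu> k"
  by (simp add: poisson_weight_def)

text \<open>The ratio of the two weights at \<open>k\<close> is \<open>exp (\<nu> - \<mu>) * (\<mu> / \<nu>) ^ k\<close>, which increases in \<open>k\<close>
  without bound; so the weights cross exactly once.\<close>

lemma poisson_weights_cross:
  assumes "0 < \<nu>" "\<nu> < \<mu>"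
  obtains K where "\<And>k. k < K \<Longrightarrow> poisson_weight \<mu> k \<le> poisson_weight \<nu> k"
    and "\<And>k. K \<le> k \<Longrightarrow> poisson_weight \<nu> k \<le> poisson_weight \<mu> k"
proof -
  define P where "P k \<longleftrightarrow> exp (\<mu> - \<nu>) \<le> (\<mu> / \<nu>) ^ k" for k
  have ratio: "1 < \<mu> / \<nu>"
    using assms by simp
  have P_iff: "P k \<longleftrightarrow> poisson_weight \<nu> k \<le> poisson_weight \<mu> k" for k
  proof -
    have "P k \<longleftrightarrow> exp (- \<nu>) * \<nu> ^ k \<le> exp (- \<mu>) * \<mu> ^ k"
      using assms by (simp add: P_def power_divide exp_diff exp_minus field_simps)
    also have "\<dots> \<longleftrightarrow> poisson_weight \<nu> k \<le> poisson_weight \<mu> k"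
      by (simp add: poisson_weight_def divide_le_cancel)
    finally show ?thesis .
  qed
  obtain k0 where "P k0"
    using real_arch_pow[OF ratio, of "exp (\<mu> - \<nu>)"] by (auto simp: P_def intro: less_imp_le)
  define K where "K = (LEAST k. P k)"
  have "P K"
    unfolding K_def using \<open>P k0\<close> by (rule LeastI)
  show thesis
  proof (rule that[of K])
    fix k assume "k < K"
    then show "poisson_weight \<mu> k \<le> poisson_weight \<nu> k"
      using not_less_Least[of k P] P_iff[of k] by (simp add: K_def)
  next
    fix k assume "K \<le> k"
    then have "(\<mu> / \<nu>) ^ K \<le> (\<mu> / \<nu>) ^ k"
      using ratio by (intro power_increasing) auto
    with \<open>P K\<close> show "poisson_weight \<nu> k \<le> poisson_weight \<mu> k"
      using P_iff[of k] by (simp add: P_def)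
  qed
qed

text \<open>If the weights cross at \<open>K\<close>, then the change of weight at \<open>k\<close> and \<open>g k - g K\<close> always have the
  same sign. Subtracting \<open>g K\<close> does not alter the difference of the averages, since both
  distributions have total mass 1.\<close>

lemma poisson_mono:
  assumes "0 < \<nu>" "\<nu> \<le> \<mu>" and "mono g"
    and sum_\<nu>: "summable (\<lambda>k. poisson_weight \<nu> k * g k)"
    and sum_\<mu>: "summable (\<lambda>k. poisson_weight \<mu> k * g k)"
  shows "(\<Sum>k. poisson_weight \<nu> k * g k) \<le> (\<Sum>k. poisson_weight \<mu> k * g k)"
proof (cases "\<nu> = \<mu>")
  case False
  with \<open>\<nu> \<le> \<mu>\<close> have "\<nu> < \<mu>"
    by simp
  with \<open>0 < \<nu>\<close> obtain K
    where below: "\<And>k. k < K \<Longrightarrow> poisson_weight \<mu> k \<le> poisson_weight \<nu> k"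
      and above: "\<And>k. K \<le> k \<Longrightarrow> poisson_weight \<nu> k \<le> poisson_weight \<mu> k"
    by (metis poisson_weights_cross)
  have nonneg: "0 \<le> (poisson_weight \<mu> k - poisson_weight \<nu> k) * (g k - g K)" for k
  proof (cases "K \<le> k")
    case True
    then show ?thesis
      using above[of k] monoD[OF \<open>mono g\<close>, of K k] by (intro mult_nonneg_nonneg) auto
  next
    case False
    then show ?thesis
      using below[of k] monoD[OF \<open>mono g\<close>, of k K] by (intro mult_nonpos_nonpos) auto
  qed
  have "(\<lambda>k. (poisson_weight \<mu> k * g k - poisson_weight \<nu> k * g k)
            - (poisson_weight \<mu> k - poisson_weight \<nu> k) * g K)
        sums (((\<Sum>k. poisson_weight \<mu> k * g k) - (\<Sum>k. poisson_weight \<nu> k * g k)) - (1 - 1) * g K)"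
    by (intro sums_diff sums_mult2 poisson_weight_sums summable_sums sum_\<nu> sum_\<mu>)
  then have "(\<lambda>k. (poisson_weight \<mu> k - poisson_weight \<nu> k) * (g k - g K))
        sums ((\<Sum>k. poisson_weight \<mu> k * g k) - (\<Sum>k. poisson_weight \<nu> k * g k))"
    by (simp add: algebra_simps)
  from sums_le[OF nonneg sums_zero this] show ?thesis
    by simp
qed simp

section \<open>Support by multiples of \<open>\<sigma>\<close>\<close>

lemma convex_wrt_slopes:
  assumes "convex_wrt \<sigma> f" "strict_mono_on {0..} \<sigma>" "0 \<le> s" "s < x" "x < t"
  shows "(f x - f s) / (\<sigma> x - \<sigma> s) \<le> (f t - f x) / (\<sigma> t - \<sigma> x)"
proof -
  have "\<sigma> s < \<sigma> x" "\<sigma> x < \<sigma> t"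
    using assms by (auto intro: strict_mono_onD)
  moreover have "0 \<le> det (vector [vector [1, 1, 1], vector [\<sigma> s, \<sigma> x, \<sigma> t],
      vector [f s, f x, f t]] :: real^3^3)"
    using assms unfolding convex_wrt_def by blast
  then have "(f x - f s) * (\<sigma> t - \<sigma> x) \<le> (f t - f x) * (\<sigma> x - \<sigma> s)"
    by (simp add: det_3 vector_3 algebra_simps)
  ultimately show ?thesis
    by (simp add: divide_le_eq pos_le_divide_eq)
qed

text \<open>Any number between the slopes to the left of \<open>x\<close> and those to the right serves as \<open>m\<close>. The
  supremum of the left slopes is such a number; it needs a point of the half-line to the left of
  \<open>x\<close>, hence \<open>0 < x\<close>.\<close>

lemma supporting_slope:
  assumes "convex_wrt \<sigma> f" "strict_mono_on {0..} \<sigma>" "0 < x"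
  obtains m where "\<And>t. 0 \<le> t \<Longrightarrow> f x + m * (\<sigma> t - \<sigma> x) \<le> f t"
proof -
  define left where "left s = (f x - f s) / (\<sigma> x - \<sigma> s)" for s
  define m where "m = (SUP s\<in>{0..<x}. left s)"
  have slopes: "left s \<le> (f t - f x) / (\<sigma> t - \<sigma> x)" if "s \<in> {0..<x}" "x < t" for s t
    using convex_wrt_slopes[OF assms(1,2), of s x t] that by (simp add: left_def)
  have bdd: "bdd_above (left ` {0..<x})"
    using slopes[of _ "x + 1"] by (intro bdd_aboveI2) auto
  have "f x + m * (\<sigma> t - \<sigma> x) \<le> f t" if "0 \<le> t" for t
  proof (cases t x rule: linorder_cases)
    case less
    then have "\<sigma> t < \<sigma> x"
      using assms that by (auto intro: strict_mono_onD)
    moreover have "left t \<le> m"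
      unfolding m_def using less that by (intro cSUP_upper bdd) auto
    ultimately show ?thesis
      by (simp add: left_def divide_le_eq algebra_simps)
  next
    case greater
    then have "\<sigma> x < \<sigma> t"
      using assms that by (auto intro: strict_mono_onD)
    moreover have "m \<le> (f t - f x) / (\<sigma> t - \<sigma> x)"
      unfolding m_def using slopes greater \<open>0 < x\<close> by (intro cSUP_least) auto
    ultimately show ?thesis
      by (simp add: pos_le_divide_eq algebra_simps)
  qed simp
  then show thesis
    by (rule that)
qed

section \<open>The operators as Poisson averages\<close>

lemma szasz_term_eq_poisson:
  "szasz_term n f x = (\<lambda>k. poisson_weight (real n * x) k * f (real k / real n))"
  by (simp add: szasz_term_def poisson_weight_def fun_eq_iff)

lemma szasz_star_term_eq_poisson:
  assumes "a > 0"
  shows "szasz_star_term n a f x =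
    (\<lambda>k. poisson_weight (x * ln a / (a powr (1 / real n) - 1)) k * f (real k / real n))"
  using assms
  by (simp add: szasz_star_term_def poisson_weight_def fun_eq_iff powr_def power_divide)

theorem theorem8p4:
  fixes a :: real and f :: "real \<Rightarrow> real"
  assumes "a > 1"
    and "continuous_on {0..} f"
    and "mono_on {0..} f"
    and "convex_wrt (\<lambda>t. a powr t) f"
  shows "\<forall>n\<ge>1. \<forall>x\<ge>0.
    summable (szasz_star_term n a f x) \<longrightarrow> summable (szasz_term n f x) \<longrightarrow>
    f x \<le> szasz_star n a f x \<and> szasz_star n a f x \<le> szasz n f x"
proof (intro allI impI)
  fix n :: nat and x :: real
  assume "1 \<le> n" "0 \<le> x"
    and star: "summable (szasz_star_term n a f x)" and classical: "summable (szasz_term n f x)"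
  define b where "b = a powr (1 / real n) - 1"
  define \<nu> where "\<nu> = x * ln a / b"
  define g where "g k = f (real k / real n)" for k
  have "0 < b"
    using \<open>a > 1\<close> \<open>1 \<le> n\<close> by (simp add: b_def)
  have star_eq: "szasz_star_term n a f x = (\<lambda>k. poisson_weight \<nu> k * g k)"
    using szasz_star_term_eq_poisson[of a n f x] \<open>a > 1\<close> by (simp add: \<nu>_def b_def g_def)
  have classical_eq: "szasz_term n f x = (\<lambda>k. poisson_weight (real n * x) k * g k)"
    by (simp add: szasz_term_eq_poisson g_def)
  show "f x \<le> szasz_star n a f x \<and> szasz_star n a f x \<le> szasz n f x"
  proof (cases "x = 0")
    case True
    \<comment> \<open>Both distributions are then the point mass at 0.\<close>
    have "(\<lambda>k. poisson_weight 0 k * g k) = (\<lambda>k. if k = 0 then g k else 0)"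
      by (auto simp: poisson_weight_def fun_eq_iff)
    then have "(\<Sum>k. poisson_weight 0 k * g k) = g 0"
      using sums_single[of 0 g] by (simp add: sums_iff)
    moreover have "\<nu> = 0"
      using True by (simp add: \<nu>_def)
    ultimately show ?thesis
      unfolding szasz_star_def szasz_def star_eq classical_eq using True by (simp add: g_def)
  next
    case False
    with \<open>0 \<le> x\<close> have "0 < x"
      by simp
    have "0 < \<nu>"
      using \<open>0 < x\<close> \<open>0 < b\<close> \<open>a > 1\<close> by (simp add: \<nu>_def)
    have "f x \<le> (\<Sum>k. poisson_weight \<nu> k * g k)"
    proof -
      have "strict_mono_on {0..} (\<lambda>t. a powr t)"
        using \<open>a > 1\<close> by (intro strict_mono_onI) simp
      with assms(4) \<open>0 < x\<close> obtain m
        where support: "\<And>t. 0 \<le> t \<Longrightarrow> f x + m * (a powr t - a powr x) \<le> f t"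
        by (metis supporting_slope)
      have powers: "(1 + b) ^ k = a powr (real k / real n)" for k
        using \<open>a > 1\<close> by (simp add: b_def powr_powr flip: powr_realpow)
      have "exp (\<nu> * (1 + b - 1)) = a powr x"
        using \<open>0 < b\<close> \<open>a > 1\<close> by (simp add: \<nu>_def powr_def)
      with poisson_generating_function[of \<nu> "1 + b"]
      have "(\<lambda>k. poisson_weight \<nu> k * a powr (real k / real n)) sums (a powr x)"
        by (simp only: powers)
      then have "(\<lambda>k. poisson_weight \<nu> k * f x + m * (poisson_weight \<nu> k * a powr (real k / real n)
              - poisson_weight \<nu> k * a powr x))
            sums (1 * f x + m * (a powr x - 1 * a powr x))"
        by (intro sums_add sums_diff sums_mult sums_mult2 poisson_weight_sums)
      then have average: "(\<lambda>k. poisson_weight \<nu> k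
            * (f x + m * (a powr (real k / real n) - a powr x))) sums f x"
        by (simp add: algebra_simps)
      have "poisson_weight \<nu> k * (f x + m * (a powr (real k / real n) - a powr x))
          \<le> poisson_weight \<nu> k * g k" for k
        using support[of "real k / real n"] \<open>0 < \<nu>\<close>
        by (intro mult_left_mono) (auto simp: g_def poisson_weight_nonneg)
      moreover have "(\<lambda>k. poisson_weight \<nu> k * g k) sums (\<Sum>k. poisson_weight \<nu> k * g k)"
        using star by (simp add: star_eq summable_sums)
      ultimately show ?thesis
        by (rule sums_le[OF _ average])
    qed
    moreover have "(\<Sum>k. poisson_weight \<nu> k * g k) \<le> (\<Sum>k. poisson_weight (real n * x) k * g k)"
    proof (rule poisson_mono)
      have "b = exp (ln a / real n) - 1"
        using \<open>a > 1\<close> by (simp add: b_def powr_def)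
      then have "ln a / real n \<le> b"
        using exp_ge_add_one_self[of "ln a / real n"] by linarith
      then have "ln a \<le> real n * b"
        using \<open>1 \<le> n\<close> by (simp add: divide_le_eq mult.commute)
      then have "x * ln a \<le> x * (real n * b)"
        using \<open>0 < x\<close> by simp
      then show "\<nu> \<le> real n * x"
        using \<open>0 < b\<close> by (simp add: \<nu>_def divide_le_eq mult_ac)
      show "mono g"
        using \<open>mono_on {0..} f\<close> \<open>1 \<le> n\<close>
        by (auto simp: g_def divide_right_mono intro!: monoI elim!: mono_onD)
    qed (use \<open>0 < \<nu>\<close> star classical in \<open>simp_all add: star_eq classical_eq\<close>)
    ultimately show ?thesis
      by (simp add: szasz_star_def szasz_def star_eq classical_eq)
  qed
qed

end
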